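(* Let $D$ be the von Koch curve. Then $\dim_{tH}D=1$.
   Context: The von Koch curve $D\subseteq\mathbb{R}^2$ is the standard self-similar curve: identifying $\mathbb{R}^2$ with $\mathbb{C}$, it is the unique non-empty compact set with $D=\bigcup_{i=1}^4\varphi_i(D)$, where $\varphi_1(z)=\frac z3$, $\varphi_2(z)=\frac13+\frac{e^{i\pi/3}}{3}z$, $\varphi_3(z)=\frac13+\frac{e^{i\pi/3}}{3}+\frac{e^{-i\pi/3}}{3}z$, $\varphi_4(z)=\frac23+\frac z3$; it carries the Euclidean metric. $\dim_H$ denotes Hausdorff dimension, with the convention $\dim_H\emptyset=-1$. The topological Hausdorff dimension is defined by $\dim_{tH}\emptyset=-1$ and, for a non-empty metric space $X$, $\dim_{tH}X=\inf\{d: X \text{ has a basis } \mathcal U \text{ of open sets such that } \dim_H\partial U\le d-1 \text{ for every } U\in\mathcal U\}$ (where $d=\infty$ is allowed, with $\infty-1=\infty$). *)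

theory Defs
  imports "HOL-Analysis.Analysis"
begin

section \<open>Hausdorff measure and Hausdorff dimension\<close>

text \<open>
  The convention for the exponent 0 is that \<open>(diam U)\<^sup>0 = 1\<close> for every non-empty \<open>U\<close>
  (also for singletons, where \<open>powr\<close> would yield \<open>0 powr 0 = 0\<close>), and the empty set never
  contributes, so that the 0-dimensional Hausdorff measure is the counting measure.
\<close>

definition diam_powr :: "real \<Rightarrow> 'a::metric_space set \<Rightarrow> ennreal" where
  "diam_powr s U =
     (if U = {} then 0 else if s = 0 then 1 else ennreal (diameter U powr s))"

text \<open>
  The boundedness requirement on the covering sets is needed because \<open>diameter\<close> is a real
  number and hence meaningless for unbounded sets. Finite covers are included, by padding them
  with empty sets. The diameters, and hence the measure, depend only on the metric restricted
  to \<open>A\<close>, since covering sets may be intersected with \<open>A\<close>.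
\<close>

definition hausdorff_premeasure :: "real \<Rightarrow> real \<Rightarrow> 'a::metric_space set \<Rightarrow> ennreal" where
  "hausdorff_premeasure s \<delta> A =
     (INF C\<in>{C :: nat \<Rightarrow> 'a set.
               A \<subseteq> (\<Union>n. C n) \<and> (\<forall>n. bounded (C n) \<and> diameter (C n) \<le> \<delta>)}.
        \<Sum>n. diam_powr s (C n))"

definition hausdorff_measure :: "real \<Rightarrow> 'a::metric_space set \<Rightarrow> ennreal" where
  "hausdorff_measure s A = (SUP \<delta>\<in>{0<..}. hausdorff_premeasure s \<delta> A)"

definition hausdorff_dim :: "'a::metric_space set \<Rightarrow> ereal" where
  "hausdorff_dim A =
     (if A = {} then -1 else INF s\<in>{s. 0 \<le> s \<and> hausdorff_measure s A = 0}. ereal s)"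

section \<open>Topological Hausdorff dimension\<close>

text \<open>The counterpart of \<^const>\<open>topological_basis\<close> for an abstract topology.\<close>

definition basis_of_topology :: "'a topology \<Rightarrow> 'a set set \<Rightarrow> bool" where
  "basis_of_topology T \<U> \<longleftrightarrow>
     (\<forall>U\<in>\<U>. openin T U) \<and> (\<forall>V. openin T V \<longrightarrow> (\<exists>\<V>\<subseteq>\<U>. \<Union>\<V> = V))"

text \<open>
  A metric space is represented by a subset \<open>X\<close> of a type of class \<open>metric_space\<close>, with the
  inherited metric. Openness and boundaries are relative to \<open>X\<close>.
\<close>

definition top_hausdorff_dim :: "'a::metric_space set \<Rightarrow> ereal" where
  "top_hausdorff_dim X =
     (if X = {} then -1
      else Inf {d. \<exists>\<U>. basis_of_topology (top_of_set X) \<U> \<and>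
                       (\<forall>U\<in>\<U>. hausdorff_dim (top_of_set X frontier_of U) \<le> d - 1)})"

section \<open>The von Koch curve\<close>

definition koch_map1 :: "complex \<Rightarrow> complex" where
  "koch_map1 z = z / 3"

definition koch_map2 :: "complex \<Rightarrow> complex" where
  "koch_map2 z = 1 / 3 + exp (\<i> * of_real pi / 3) / 3 * z"

definition koch_map3 :: "complex \<Rightarrow> complex" where
  "koch_map3 z = 1 / 3 + exp (\<i> * of_real pi / 3) / 3 + exp (- \<i> * of_real pi / 3) / 3 * z"

definition koch_map4 :: "complex \<Rightarrow> complex" where
  "koch_map4 z = 2 / 3 + z / 3"

definition koch_curve :: "complex set" where
  "koch_curve = (THE D. D \<noteq> {} \<and> compact D \<and>
     D = koch_map1 ` D \<union> koch_map2 ` D \<union> koch_map3 ` D \<union> koch_map4 ` D)"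

end

theory Submission
  imports Defs
begin

text \<open>
  A connected space with two points has no basis of clopen sets, which gives the lower bound.
  For the upper bound, the level-\<open>n\<close> cells of the Koch curve are small, and any two of them meet
  in a finite set: the curve lies in the triangle with vertices \<open>0\<close>, \<open>1\<close> and \<open>1/2 + \<i>\<surd>3/6\<close>, whose
  four images lie over consecutive intervals of the real axis and touch only in their corners.
  Removing from the curve all cells that miss a given point leaves a small neighbourhood of
  that point with finite boundary.
\<close>

section \<open>Hausdorff dimension of small sets\<close>

lemma hausdorff_dim_nonneg: "A \<noteq> {} \<Longrightarrow> 0 \<le> hausdorff_dim A"
  by (auto simp: hausdorff_dim_def intro!: INF_greatest)

text \<open>Singletons cover the set, and for a positive exponent each contributes
  \<open>0 powr s\<close>, which is 0.\<close>

lemma hausdorff_measure_countable: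
  assumes "countable A" "0 < s"
  shows "hausdorff_measure s A = 0"
proof -
  define C where "C n = (if A = {} then {} else {from_nat_into A n})" for n
  have "A \<subseteq> (\<Union>n. C n)"
    using range_from_nat_into[OF _ assms(1)] by (auto simp: C_def)
  moreover have "diam_powr s (C n) = 0" "bounded (C n)" "diameter (C n) = 0" for n
    using assms(2) by (simp_all add: C_def diam_powr_def)
  ultimately have "hausdorff_premeasure s \<delta> A \<le> 0" if "0 < \<delta>" for \<delta>
    unfolding hausdorff_premeasure_def using that
    by (intro INF_lower2[of C]) auto
  then show ?thesis
    unfolding hausdorff_measure_def by (intro antisym SUP_least) auto
qed

lemma hausdorff_dim_countable_le:
  assumes "countable A"
  shows "hausdorff_dim A \<le> 0"
proof (cases "A = {}")
  case False
  \<comment> \<open>Exponent 0 does not qualify, since there the measure counts points; the infimum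
    0 is only approached through positive \<open>s\<close>.\<close>
  have "hausdorff_dim A \<le> 0 + ereal s" if "0 < s" for s
  proof -
    have "hausdorff_dim A \<le> ereal s"
      unfolding hausdorff_dim_def if_not_P[OF False]
      by (rule INF_lower) (use that hausdorff_measure_countable[OF assms that] in simp)
    then show ?thesis
      by simp
  qed
  then show ?thesis
    by (rule ereal_le_epsilon2)
qed (simp add: hausdorff_dim_def)

section \<open>Bounds for the topological Hausdorff dimension\<close>

text \<open>For \<open>d < 1\<close> the boundaries of basis sets have negative dimension, so they
  are empty and the basis sets are clopen. Connectedness leaves only the empty set and
  \<open>X\<close>.\<close>

lemma top_hausdorff_dim_ge_1:
  fixes X :: "'a::metric_space set"
  assumes conn: "connected X" and xy: "x \<in> X" "y \<in> X" "x \<noteq> y"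
  shows "1 \<le> top_hausdorff_dim X"
proof -
  have "1 \<le> d" if bas: "basis_of_topology (top_of_set X) \<U>"
    and dim: "\<forall>U\<in>\<U>. hausdorff_dim (top_of_set X frontier_of U) \<le> d - 1" for d \<U>
  proof (rule ccontr)
    assume "\<not> 1 \<le> d"
    then have d: "d - 1 < 0"
      by (cases d) (auto simp: one_ereal_def zero_ereal_def)
    have triv: "U = {} \<or> U = X" if "U \<in> \<U>" for U
    proof -
      have "top_of_set X frontier_of U = {}"
        using dim that d hausdorff_dim_nonneg[of "top_of_set X frontier_of U"]
        by (meson leD order_trans)
      moreover have op: "openin (top_of_set X) U"
        using bas that by (auto simp: basis_of_topology_def)
      ultimately have "closedin (top_of_set X) U"
        using frontier_of_subset_eq[of U "top_of_set X"] openin_subset[OF op] by auto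
      with op conn show ?thesis
        by (auto simp: connected_clopen)
    qed
    \<comment> \<open>A trivial basis cannot separate \<open>x\<close> from \<open>y\<close>: the
      basis set around \<open>x\<close> inside this open set would be all of
      \<open>X\<close>.\<close>
    have "openin (top_of_set X) (X - {y})"
      by (simp add: openin_delete)
    then obtain \<V> where \<V>: "\<V> \<subseteq> \<U>" "\<Union>\<V> = X - {y}"
      using bas by (meson basis_of_topology_def)
    then obtain U where "U \<in> \<V>" "x \<in> U"
      using xy by blast
    with \<V> triv have "X \<subseteq> X - {y}"
      by blast
    with xy show False
      by blast
  qed
  then show ?thesis
    using xy by (auto simp: top_hausdorff_dim_def intro!: Inf_greatest)
qed

lemma top_hausdorff_dim_le_1:
  fixes X :: "'a::metric_space set"
  assumes cover: "\<And>e. 0 < e \<Longrightarrow> \<exists>\<C>. finite \<C> \<and> \<Union>\<C> = X \<and> (\<forall>C\<in>\<C>. closed C) \<and>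
      (\<forall>C\<in>\<C>. \<forall>x\<in>C. \<forall>y\<in>C. dist x y < e) \<and> pairwise (\<lambda>A B. countable (A \<inter> B)) \<C>"
  shows "top_hausdorff_dim X \<le> 1"
proof -
  define \<U> where
    "\<U> = {U. openin (top_of_set X) U \<and> countable (top_of_set X frontier_of U)}"
  have nhd: "\<exists>U\<in>\<U>. x \<in> U \<and> U \<subseteq> V" if V: "openin (top_of_set X) V" "x \<in> V" for V x
  proof -
    have VX: "V \<subseteq> X"
      using V(1) by (rule openin_imp_subset)
    obtain e where e: "0 < e" "\<And>y. y \<in> X \<Longrightarrow> dist y x < e \<Longrightarrow> y \<in> V"
      using V unfolding openin_euclidean_subtopology_iff by meson
    obtain \<C> where \<C>: "finite \<C>" "\<Union>\<C> = X" "\<forall>C\<in>\<C>. closed C"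
      "\<forall>C\<in>\<C>. \<forall>x\<in>C. \<forall>y\<in>C. dist x y < e"
      "pairwise (\<lambda>A B. countable (A \<inter> B)) \<C>"
      using cover[OF e(1)] by (elim exE conjE)
    \<comment> \<open>\<open>P\<close> collects the pieces through \<open>x\<close>,
      \<open>Q\<close> the others. The neighbourhood will be \<open>X - Q\<close>: it lies in
      \<open>P\<close>, hence within distance \<open>e\<close> of \<open>x\<close>.\<close>
    define P where "P = \<Union>{C \<in> \<C>. x \<in> C}"
    define Q where "Q = \<Union>{C \<in> \<C>. x \<notin> C}"
    have closed: "closed P" "closed Q"
      unfolding P_def Q_def using \<C> by (auto intro!: closed_Union)
    have PQ: "P \<union> Q = X"
      unfolding P_def Q_def using \<C>(2) by blast
    have "openin (top_of_set X) (X - Q)"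
      using closed(2) PQ by (intro openin_diff) (auto intro!: closed_subset)
    moreover have "countable (top_of_set X frontier_of (X - Q))"
    proof (rule countable_subset)
      \<comment> \<open>The boundary is the closure minus the open set itself, so it lies in
        \<open>P\<close> and in \<open>Q\<close>. A piece through \<open>x\<close> and a piece
        avoiding \<open>x\<close> are distinct, so their intersection is countable.\<close>
      have "top_of_set X closure_of (X - Q) \<subseteq> P"
        using closed(1) PQ by (intro closure_of_minimal) (auto intro!: closed_subset)
      moreover have "top_of_set X interior_of (X - Q) = X - Q"
        using calculation \<open>openin (top_of_set X) (X - Q)\<close> interior_of_openin by blast
      moreover have "top_of_set X closure_of (X - Q) \<subseteq> X"
        by (metis closure_of_subset_topspace topspace_euclidean_subtopology)
      ultimately have "top_of_set X frontier_of (X - Q) \<subseteq> P \<inter> Q"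
        unfolding frontier_of_def by auto
      also have "P \<inter> Q = (\<Union>A\<in>{C \<in> \<C>. x \<in> C}. \<Union>B\<in>{C \<in> \<C>. x \<notin> C}. A \<inter> B)"
        unfolding P_def Q_def by auto
      finally show "top_of_set X frontier_of (X - Q) \<subseteq>
          (\<Union>A\<in>{C \<in> \<C>. x \<in> C}. \<Union>B\<in>{C \<in> \<C>. x \<notin> C}. A \<inter> B)" .
      show "countable (\<Union>A\<in>{C \<in> \<C>. x \<in> C}. \<Union>B\<in>{C \<in> \<C>. x \<notin> C}. A \<inter> B)"
        using \<C>(1) pairwiseD[OF \<C>(5)]
        by (intro countable_UN) (auto intro: countable_finite)
    qed
    ultimately have "X - Q \<in> \<U>"
      by (simp add: \<U>_def)
    moreover have "x \<in> X - Q"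
      using V(2) VX by (auto simp: Q_def)
    moreover have "X - Q \<subseteq> V"
    proof
      fix y assume "y \<in> X - Q"
      then obtain C where "C \<in> \<C>" "x \<in> C" "y \<in> C"
        using PQ by (auto simp: P_def)
      then have "y \<in> X" "dist y x < e"
        using \<C>(2,4) by auto
      then show "y \<in> V"
        by (rule e(2))
    qed
    ultimately show ?thesis
      by blast
  qed
  have "basis_of_topology (top_of_set X) \<U>"
    unfolding basis_of_topology_def
  proof (intro conjI allI impI)
    fix V assume V: "openin (top_of_set X) V"
    show "\<exists>\<V>\<subseteq>\<U>. \<Union>\<V> = V"
      using nhd[OF V] by (intro exI[of _ "{U \<in> \<U>. U \<subseteq> V}"]) blast
  qed (simp add: \<U>_def)
  moreover have "hausdorff_dim (top_of_set X frontier_of U) \<le> 1 - 1" if "U \<in> \<U>" for U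
    using that by (auto simp: \<U>_def intro: hausdorff_dim_countable_le)
  \<comment> \<open>This covers the empty space, whose dimension is -1 by convention.\<close>
  moreover have "- 1 \<le> (1 :: ereal)"
    by (simp add: one_ereal_def)
  ultimately show ?thesis
    by (cases "X = {}") (auto simp: top_hausdorff_dim_def intro!: Inf_lower)
qed

section \<open>Attractors of iterated function systems\<close>

definition hutchinson :: "('a \<Rightarrow> 'a) set \<Rightarrow> 'a set \<Rightarrow> 'a set" where
  "hutchinson S A = (\<Union>f\<in>S. f ` A)"

text \<open>Meant for a set \<open>A\<close> that the operator maps into itself, so that the
  iterates decrease.\<close>

definition attractor :: "('a \<Rightarrow> 'a) set \<Rightarrow> 'a set \<Rightarrow> 'a set" where
  "attractor S A = (\<Inter>n. (hutchinson S ^^ n) A)"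

lemma hutchinson_mono: "A \<subseteq> B \<Longrightarrow> hutchinson S A \<subseteq> hutchinson S B"
  unfolding hutchinson_def by blast

lemma hutchinson_funpow_decseq:
  assumes "hutchinson S A \<subseteq> A"
  shows "decseq (\<lambda>n. (hutchinson S ^^ n) A)"
proof (rule decseq_SucI)
  show "(hutchinson S ^^ Suc n) A \<subseteq> (hutchinson S ^^ n) A" for n
    by (induction n) (simp_all add: assms hutchinson_mono)
qed

text \<open>A point of the attractor lies, for each \<open>n\<close>, in the image of the
  \<open>n\<close>-th iterate under some map. By pigeonhole one map serves infinitely many
  \<open>n\<close>, hence all \<open>n\<close> because the iterates decrease. Injectivity then moves
  the image past the intersection, so no topology enters.\<close>

lemma hutchinson_attractor:
  assumes "finite S" "\<And>f. f \<in> S \<Longrightarrow> inj f" "hutchinson S A \<subseteq> A"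
  shows "hutchinson S (attractor S A) = attractor S A"
proof
  note dec = decseqD[OF hutchinson_funpow_decseq[OF assms(3)]]
  have "hutchinson S (attractor S A) \<subseteq> (hutchinson S ^^ n) A" for n
  proof -
    have "hutchinson S (attractor S A) \<subseteq> hutchinson S ((hutchinson S ^^ n) A)"
      by (intro hutchinson_mono) (auto simp: attractor_def)
    also have "\<dots> \<subseteq> (hutchinson S ^^ n) A"
      using dec[of n "Suc n"] by simp
    finally show ?thesis .
  qed
  then show "hutchinson S (attractor S A) \<subseteq> attractor S A"
    by (auto simp: attractor_def)
next
  note dec = decseqD[OF hutchinson_funpow_decseq[OF assms(3)]]
  show "attractor S A \<subseteq> hutchinson S (attractor S A)"
  proof
    fix x assume x: "x \<in> attractor S A"
    have "\<forall>n. \<exists>f\<in>S. x \<in> f ` (hutchinson S ^^ n) A"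
    proof
      fix n
      have "x \<in> (hutchinson S ^^ Suc n) A"
        using x unfolding attractor_def by blast
      then show "\<exists>f\<in>S. x \<in> f ` (hutchinson S ^^ n) A"
        by (simp add: hutchinson_def)
    qed
    then obtain g where g: "\<And>n. g n \<in> S" "\<And>n. x \<in> g n ` (hutchinson S ^^ n) A"
      by metis
    then obtain f where f: "f \<in> S" "\<exists>\<^sub>\<infinity>n. g n = f"
      using pigeonhole_infinite_rel[of UNIV S "\<lambda>n f. g n = f"] assms(1)
      by (auto simp: INFM_iff_infinite)
    have "x \<in> f ` (hutchinson S ^^ n) A" for n
    proof -
      obtain m where "m \<ge> n" "g m = f"
        using f(2) unfolding INFM_nat_le by blast
      then show ?thesis
        using g(2)[of m] dec[of n m] by blast
    qed
    then have "x \<in> f ` attractor S A"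
      unfolding attractor_def using assms(2)[OF f(1)] by (subst image_INT[of _ UNIV]) auto
    with f(1) show "x \<in> hutchinson S (attractor S A)"
      by (auto simp: hutchinson_def)
  qed
qed

lemma hutchinson_compact:
  fixes A :: "'a::topological_space set"
  assumes "finite S" "\<And>f. f \<in> S \<Longrightarrow> continuous_on UNIV f" "compact A"
  shows "compact (hutchinson S A)"
  unfolding hutchinson_def
  using assms continuous_on_subset by (blast intro: compact_continuous_image)

text \<open>A point of \<open>D\<close> farthest from \<open>E\<close> is the image of a point at least \<open>1/c\<close> times as far away.\<close>

lemma hutchinson_invariant_subset:
  fixes D E :: "'a::metric_space set"
  assumes "0 \<le> c" "c < 1"
    and contr: "\<And>f x y. f \<in> S \<Longrightarrow> dist (f x) (f y) \<le> c * dist x y"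
    and D: "compact D" "D \<subseteq> hutchinson S D"
    and E: "closed E" "E \<noteq> {}" "hutchinson S E \<subseteq> E"
  shows "D \<subseteq> E"
proof (cases "D = {}")
  case False
  have "continuous_on D (\<lambda>x. infdist x E)"
    by (intro continuous_on_infdist continuous_on_id)
  from continuous_attains_sup[OF D(1) False this]
  obtain x where x: "x \<in> D" "\<forall>y\<in>D. infdist y E \<le> infdist x E"
    by (elim bexE)
  obtain f y where f: "f \<in> S" "y \<in> D" "x = f y"
    using x(1) D(2) by (auto simp: hutchinson_def)
  have le: "infdist x E \<le> c * dist y z" if "z \<in> E" for z
  proof -
    have "f z \<in> E"
      using that f E by (auto simp: hutchinson_def)
    then show ?thesis
      using contr[OF f(1), of y z] f(3) infdist_le order_trans by metis
  qed
  \<comment> \<open>Take the infimum over \<open>z\<close> in \<open>le\<close>; the case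
    \<open>c = 0\<close> is split off because the proof divides by \<open>c\<close>.\<close>
  have "infdist x E \<le> c * infdist y E"
  proof (cases "c = 0")
    case True
    then show ?thesis using le E(2) by auto
  next
    case False
    then have "infdist x E / c \<le> infdist y E"
      unfolding infdist_notempty[OF E(2)] using le assms(1) E(2)
      by (intro cINF_greatest) (auto simp: field_simps infdist_notempty[OF E(2), symmetric])
    then show ?thesis
      using False assms(1) by (simp add: field_simps)
  qed
  also have "\<dots> \<le> c * infdist x E"
    using bspec[OF x(2) f(2)] assms(1) by (rule mult_left_mono)
  finally have "infdist x E \<le> 0"
    using assms(2) infdist_nonneg[of x E] by (simp add: mult_le_cancel_right1 not_less)
  then have "infdist y E = 0" if "y \<in> D" for y
    using bspec[OF x(2) that] infdist_nonneg[of y E] by linarith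
  then show ?thesis
    using in_closed_iff_infdist_zero[OF E(1,2)] by blast
qed simp

section \<open>Cells of a self-similar set\<close>

primrec cells :: "('a \<Rightarrow> 'a) set \<Rightarrow> 'a set \<Rightarrow> nat \<Rightarrow> 'a set set" where
  "cells S D 0 = {D}"
| "cells S D (Suc n) = (\<lambda>(f, C). f ` C) ` (S \<times> cells S D n)"

lemma finite_cells: "finite S \<Longrightarrow> finite (cells S D n)"
  by (induction n) auto

lemma Union_cells:
  assumes "hutchinson S D = D"
  shows "\<Union>(cells S D n) = D"
proof (induction n)
  case (Suc n)
  have "\<Union>(cells S D (Suc n)) = hutchinson S (\<Union>(cells S D n))"
    by (force simp: hutchinson_def)
  with Suc assms show ?case
    by simp
qed simp

lemma cells_compact:
  fixes D :: "'a::topological_space set"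
  assumes "\<And>f. f \<in> S \<Longrightarrow> continuous_on UNIV f" "compact D" "C \<in> cells S D n"
  shows "compact C"
  using assms(3)
proof (induction n arbitrary: C)
  case (Suc n)
  then show ?case
    using assms(1) by (auto intro!: compact_continuous_image intro: continuous_on_subset)
qed (use assms in auto)

lemma cells_dist_le:
  fixes D :: "'a::metric_space set"
  assumes "0 \<le> c" and contr: "\<And>f x y. f \<in> S \<Longrightarrow> dist (f x) (f y) \<le> c * dist x y"
    and "bounded D" "C \<in> cells S D n" "x \<in> C" "y \<in> C"
  shows "dist x y \<le> c ^ n * diameter D"
  using assms(4-6)
proof (induction n arbitrary: C x y)
  case 0
  then show ?case
    using assms(3) by (auto simp: diameter_bounded_bound)
next
  case (Suc n)
  then obtain f B u v where f: "f \<in> S" "B \<in> cells S D n" "u \<in> B" "v \<in> B" "x = f u" "y = f v"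
    by auto
  have "dist x y \<le> c * dist u v"
    using contr f by simp
  also have "\<dots> \<le> c * (c ^ n * diameter D)"
    using Suc.IH[OF f(2-4)] assms(1) by (rule mult_left_mono)
  finally show ?case
    by (simp add: mult_ac)
qed

text \<open>Compare the outermost maps. If they agree, injectivity reduces the intersection to that
  of two distinct cells one level down; if they differ, it lies in the intersection of two
  first-level pieces. Cells are sets, not words, so compositions with equal images count
  once.\<close>

lemma cells_pairwise_countable:
  assumes "hutchinson S D = D" "\<And>f. f \<in> S \<Longrightarrow> inj f"
    and inter: "\<And>f g. f \<in> S \<Longrightarrow> g \<in> S \<Longrightarrow> f \<noteq> g \<Longrightarrow> countable (f ` D \<inter> g ` D)"
  shows "pairwise (\<lambda>A B. countable (A \<inter> B)) (cells S D n)"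
proof (induction n)
  case (Suc n)
  show ?case
  proof (rule pairwiseI)
    fix X Y assume XY: "X \<in> cells S D (Suc n)" "Y \<in> cells S D (Suc n)" "X \<noteq> Y"
    obtain f A where f: "f \<in> S" "A \<in> cells S D n" "X = f ` A"
      using XY(1) by auto
    obtain g B where g: "g \<in> S" "B \<in> cells S D n" "Y = g ` B"
      using XY(2) by auto
    note fg = f(1) g(1) f(2) g(2) f(3) g(3)
    show "countable (X \<inter> Y)"
    proof (cases "f = g")
      case True
      then have "X \<inter> Y = f ` (A \<inter> B)"
        using fg assms(2) by (simp add: image_Int)
      moreover have "countable (A \<inter> B)"
        using True fg XY(3) pairwiseD[OF Suc] by blast
      ultimately show ?thesis
        by simp
    next
      case False
      have "A \<subseteq> D" "B \<subseteq> D"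
        using fg(3,4) Union_cells[OF assms(1), of n] by auto
      then have "X \<inter> Y \<subseteq> f ` D \<inter> g ` D"
        using fg by blast
      then show ?thesis
        using inter[OF fg(1,2) False] countable_subset by blast
    qed
  qed
qed (simp add: pairwise_def)

lemma top_hausdorff_dim_self_similar_le_1:
  fixes D :: "'a::metric_space set"
  assumes "finite S" "0 \<le> c" "c < 1"
    and contr: "\<And>f x y. f \<in> S \<Longrightarrow> dist (f x) (f y) \<le> c * dist x y"
    and inj: "\<And>f. f \<in> S \<Longrightarrow> inj f"
    and cont: "\<And>f. f \<in> S \<Longrightarrow> continuous_on UNIV f"
    and D: "compact D" "hutchinson S D = D"
    and inter: "\<And>f g. f \<in> S \<Longrightarrow> g \<in> S \<Longrightarrow> f \<noteq> g \<Longrightarrow> countable (f ` D \<inter> g ` D)"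
  shows "top_hausdorff_dim D \<le> 1"
proof (rule top_hausdorff_dim_le_1)
  fix e :: real assume "0 < e"
  \<comment> \<open>Choose the level so deep that the bound on the cell diameters drops below
    \<open>e\<close>.\<close>
  have "(\<lambda>n. c ^ n * diameter D) \<longlonglongrightarrow> 0"
    using assms(2,3) by (intro tendsto_mult_left_zero LIMSEQ_power_zero) auto
  then obtain n where n: "c ^ n * diameter D < e"
    using order_tendstoD(2)[OF _ \<open>0 < e\<close>] eventually_happens' sequentially_bot by blast
  have "\<forall>C\<in>cells S D n. \<forall>x\<in>C. \<forall>y\<in>C. dist x y < e"
    using cells_dist_le[OF assms(2) contr compact_imp_bounded[OF D(1)]] n by (meson order_le_less_trans)
  then show "\<exists>\<C>. finite \<C> \<and> \<Union>\<C> = D \<and> (\<forall>C\<in>\<C>. closed C) \<and>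
      (\<forall>C\<in>\<C>. \<forall>x\<in>C. \<forall>y\<in>C. dist x y < e) \<and> pairwise (\<lambda>A B. countable (A \<inter> B)) \<C>"
    using finite_cells[OF assms(1)] Union_cells[OF D(2)]
      compact_imp_closed[OF cells_compact[OF cont D(1)]]
      cells_pairwise_countable[OF D(2) inj inter]
    by (intro exI[of _ "cells S D n"] conjI ballI) simp_all
qed

section \<open>The Koch curve\<close>

definition koch_maps :: "(complex \<Rightarrow> complex) set" where
  "koch_maps = {koch_map1, koch_map2, koch_map3, koch_map4}"

lemma exp_pi_third: "exp (\<i> * of_real pi / 3) = Complex (1 / 2) (sqrt 3 / 2)"
  using cis_conv_exp[of "pi / 3"] by (simp add: complex_eq_iff cos_60 sin_60)

lemma exp_minus_pi_third: "exp (- (\<i> * of_real pi / 3)) = Complex (1 / 2) (- sqrt 3 / 2)"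
  using cis_conv_exp[of "- (pi / 3)"] by (simp add: complex_eq_iff cos_60 sin_60)

lemma dist_koch_maps:
  assumes "f \<in> koch_maps"
  shows "dist (f x) (f y) = 1 / 3 * dist x y"
proof -
  have "norm (exp (\<i> * of_real pi / 3)) = 1" "norm (exp (- \<i> * of_real pi / 3)) = 1"
    by simp_all
  moreover have "dist (a + b * x) (a + b * y) = norm b * dist x y" for a b :: complex
    by (simp add: dist_norm flip: norm_mult right_diff_distrib)
  \<comment> \<open>All four maps have the form \<open>a + u / 3 * z\<close> with \<open>u\<close>
    of modulus 1: a rotation factor for the two middle maps, 1 for the outer ones.\<close>
  ultimately have rot: "dist (a + u / 3 * x) (a + u / 3 * y) = 1 / 3 * dist x y"
    if "norm u = 1" for a u
    using that by (simp only: norm_divide) simp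
  show ?thesis
    using assms rot[of 1 0] rot[of 1 "2/3"] rot[of "exp (\<i> * of_real pi / 3)" "1/3"]
      rot[of "exp (- \<i> * of_real pi / 3)" "1/3 + exp (\<i> * of_real pi / 3) / 3"]
    unfolding koch_maps_def
    by (auto simp: koch_map1_def koch_map2_def koch_map3_def koch_map4_def)
qed

lemma inj_koch_maps: "f \<in> koch_maps \<Longrightarrow> inj f"
  using dist_koch_maps by (intro injI) (metis dist_eq_0_iff divide_eq_0_iff mult_eq_0_iff zero_neq_one zero_neq_numeral)

lemma continuous_koch_maps: "f \<in> koch_maps \<Longrightarrow> continuous_on A f"
  unfolding koch_maps_def koch_map1_def koch_map2_def koch_map3_def koch_map4_def
  by (auto intro!: continuous_intros)

text \<open>Consecutive pieces share an endpoint, which glues them into a connected chain from 0 to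
  1.\<close>

lemma koch_map_endpoints:
  "koch_map1 0 = 0" "koch_map1 1 = koch_map2 0" "koch_map2 1 = koch_map3 0"
  "koch_map3 1 = koch_map4 0" "koch_map4 1 = 1"
  by (simp_all add: koch_map1_def koch_map2_def koch_map3_def koch_map4_def
      exp_pi_third exp_minus_pi_third complex_eq_iff)

section \<open>Coordinates and the invariant triangle\<close>

lemma koch_map_Re:
  "Re (koch_map1 z) = Re z / 3"
  "Re (koch_map2 z) = 1 / 3 + Re z / 6 - sqrt 3 * Im z / 6"
  "Re (koch_map3 z) = 1 / 2 + Re z / 6 + sqrt 3 * Im z / 6"
  "Re (koch_map4 z) = 2 / 3 + Re z / 3"
  by (simp_all add: koch_map1_def koch_map2_def koch_map3_def koch_map4_def
      exp_pi_third exp_minus_pi_third field_simps)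

lemma koch_map_Im:
  "Im (koch_map1 z) = Im z / 3"
  "Im (koch_map2 z) = sqrt 3 * Re z / 6 + Im z / 6"
  "Im (koch_map3 z) = sqrt 3 / 6 - sqrt 3 * Re z / 6 + Im z / 6"
  "Im (koch_map4 z) = Im z / 3"
  by (simp_all add: koch_map1_def koch_map2_def koch_map3_def koch_map4_def
      exp_pi_third exp_minus_pi_third field_simps)

text \<open>The filled isosceles triangle over the base from 0 to 1 with base angles pi/6. The
  slopes are cleared of denominators, so the sides are linear in \<open>Re z\<close> and
  \<open>sqrt 3 * Im z\<close>.\<close>

definition koch_triangle :: "complex set" where
  "koch_triangle = {z. 0 \<le> Im z \<and> sqrt 3 * Im z \<le> Re z \<and> sqrt 3 * Im z \<le> 1 - Re z}"

lemma koch_triangle_invariant: "hutchinson koch_maps koch_triangle \<subseteq> koch_triangle"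
proof -
  have "f z \<in> koch_triangle" if f: "f \<in> koch_maps" and "z \<in> koch_triangle" for f z
  proof -
    have z: "0 \<le> Im z" "sqrt 3 * Im z \<le> Re z" "sqrt 3 * Im z \<le> 1 - Re z"
      using that(2) by (auto simp: koch_triangle_def)
    have p: "0 \<le> sqrt 3 * Im z"
      using z by simp
    then have "0 \<le> Re z" "Re z \<le> 1"
      using z by linarith+
    then have q: "0 \<le> sqrt 3 * Re z" "sqrt 3 * Re z \<le> sqrt 3"
      by simp_all
    \<comment> \<open>Once products of two roots are absorbed, everything is linear in
      \<open>Re z\<close>, \<open>Im z\<close>, \<open>sqrt 3\<close> and the products of
      \<open>sqrt 3\<close> with \<open>Re z\<close> and \<open>Im z\<close>.\<close>
    have "sqrt 3 * (sqrt 3 * x) = 3 * x" for x :: real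
      by (simp flip: mult.assoc)
    then have s: "sqrt 3 * (Im z / 3) = sqrt 3 * Im z / 3"
      "sqrt 3 * (sqrt 3 * Re z / 6 + Im z / 6) = Re z / 2 + sqrt 3 * Im z / 6"
      "sqrt 3 * (sqrt 3 / 6 - sqrt 3 * Re z / 6 + Im z / 6) = 1 / 2 - Re z / 2 + sqrt 3 * Im z / 6"
      by (simp_all add: distrib_left right_diff_distrib)
    consider "f = koch_map1" | "f = koch_map2" | "f = koch_map3" | "f = koch_map4"
      using f by (auto simp: koch_maps_def)
    then have "0 \<le> Im (f z) \<and> sqrt 3 * Im (f z) \<le> Re (f z) \<and> sqrt 3 * Im (f z) \<le> 1 - Re (f z)"
      using z p q by cases (simp_all only: koch_map_Re koch_map_Im s, linarith+)
    then show ?thesis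
      by (simp add: koch_triangle_def)
  qed
  then show ?thesis
    by (auto simp: hutchinson_def)
qed

lemma convex_koch_triangle: "convex koch_triangle"
proof -
  have "koch_triangle = {z. 0 \<le> inner \<i> z} \<inter> {z. inner (Complex (-1) (sqrt 3)) z \<le> 0} \<inter>
      {z. inner (Complex 1 (sqrt 3)) z \<le> 1}"
    by (auto simp: koch_triangle_def inner_complex_def)
  then show ?thesis
    by (metis convex_Int convex_halfspace_ge convex_halfspace_le)
qed

lemma compact_koch_triangle: "compact koch_triangle"
proof -
  have "closed koch_triangle"
    unfolding koch_triangle_def Collect_conj_eq
    by (intro closed_Int closed_Collect_le continuous_intros)
  moreover have "koch_triangle \<subseteq> cball 0 2"
  proof
    fix z assume "z \<in> koch_triangle"
    then have z: "0 \<le> Im z" "sqrt 3 * Im z \<le> Re z" "sqrt 3 * Im z \<le> 1 - Re z"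
      by (auto simp: koch_triangle_def)
    have "1 * Im z \<le> sqrt 3 * Im z"
      using z by (intro mult_right_mono) auto
    with z have "\<bar>Re z\<bar> \<le> 1" "\<bar>Im z\<bar> \<le> 1"
      by auto
    then show "z \<in> cball 0 2"
      using cmod_le[of z] by simp
  qed
  ultimately show ?thesis
    using bounded_cball bounded_subset compact_eq_bounded_closed by blast
qed

section \<open>Existence, uniqueness and connectedness of the curve\<close>

lemma hutchinson_koch_maps:
  "hutchinson koch_maps A = koch_map1 ` A \<union> koch_map2 ` A \<union> koch_map3 ` A \<union> koch_map4 ` A"
  by (auto simp: hutchinson_def koch_maps_def)

lemma connected_hutchinson_koch_maps:
  assumes "connected A" "0 \<in> A" "1 \<in> A"
  shows "connected (hutchinson koch_maps A)"
proof -
  have conn: "connected (f ` A)" if "f \<in> koch_maps" for f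
    using that assms(1) continuous_koch_maps by (intro connected_continuous_image)
  have "koch_map2 0 \<in> koch_map1 ` A" "koch_map3 0 \<in> koch_map2 ` A" "koch_map4 0 \<in> koch_map3 ` A"
    using assms(3) by (auto simp flip: koch_map_endpoints(2-4))
  then have "koch_map2 0 \<in> koch_map1 ` A \<inter> koch_map2 ` A"
    "koch_map3 0 \<in> (koch_map1 ` A \<union> koch_map2 ` A) \<inter> koch_map3 ` A"
    "koch_map4 0 \<in> (koch_map1 ` A \<union> koch_map2 ` A \<union> koch_map3 ` A) \<inter> koch_map4 ` A"
    using assms(2) by auto
  then show ?thesis
    unfolding hutchinson_koch_maps
    by (intro connected_Un conn) (auto simp: koch_maps_def)
qed

text \<open>The points 0 and 1 are carried through the induction because the gluing of the four
  images needs them.\<close>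

lemma koch_approximation:
  "compact ((hutchinson koch_maps ^^ n) koch_triangle) \<and>
   connected ((hutchinson koch_maps ^^ n) koch_triangle) \<and>
   {0, 1} \<subseteq> (hutchinson koch_maps ^^ n) koch_triangle"
proof (induction n)
  case 0
  show ?case
    using compact_koch_triangle convex_connected[OF convex_koch_triangle]
    by (simp add: koch_triangle_def)
next
  case (Suc n)
  let ?A = "(hutchinson koch_maps ^^ n) koch_triangle"
  have "compact (hutchinson koch_maps ?A)"
    using Suc continuous_koch_maps by (intro hutchinson_compact) (auto simp: koch_maps_def)
  moreover have "connected (hutchinson koch_maps ?A)"
    using Suc by (intro connected_hutchinson_koch_maps) auto
  moreover have "koch_map1 0 \<in> hutchinson koch_maps ?A" "koch_map4 1 \<in> hutchinson koch_maps ?A"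
    using Suc unfolding hutchinson_koch_maps by blast+
  ultimately show ?case
    by (simp add: koch_map_endpoints)
qed

text \<open>The definite description needs existence and uniqueness. The attractor of the triangle
  gives the first; for the second, two nonempty compact invariant sets contain each other by
  \<open>hutchinson_invariant_subset\<close>.\<close>

lemma koch_curve_eq_attractor: "koch_curve = attractor koch_maps koch_triangle"
  and hutchinson_koch_curve: "hutchinson koch_maps koch_curve = koch_curve"
  and compact_koch_curve: "compact koch_curve"
proof -
  let ?D = "attractor koch_maps koch_triangle"
  have "0 \<in> ?D"
    using koch_approximation by (auto simp: attractor_def)
  have cpt: "compact ?D"
    unfolding attractor_def using koch_approximation
    by (intro compact_Inter) (auto simp: compact_imp_closed)
  have inv: "hutchinson koch_maps ?D = ?D"
    using koch_triangle_invariant inj_koch_maps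
    by (intro hutchinson_attractor) (auto simp: koch_maps_def)
  have sub: "D \<subseteq> E" if "compact D" "D = hutchinson koch_maps D"
    "compact E" "E \<noteq> {}" "E = hutchinson koch_maps E" for D E
  proof (rule hutchinson_invariant_subset[of "1 / 3" koch_maps])
    show "dist (f x) (f y) \<le> 1 / 3 * dist x y" if "f \<in> koch_maps" for f x y
      using dist_koch_maps[OF that] by (rule eq_refl)
  qed (use that(1,3,4) equalityD1[OF that(2)] equalityD2[OF that(5)] in \<open>simp_all add: compact_imp_closed\<close>)
  show eq: "koch_curve = ?D"
    unfolding koch_curve_def hutchinson_koch_maps[symmetric]
  proof (rule the_equality)
    show "?D \<noteq> {} \<and> compact ?D \<and> ?D = hutchinson koch_maps ?D"
      using \<open>0 \<in> ?D\<close> cpt inv by auto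
    show "D = ?D" if "D \<noteq> {} \<and> compact D \<and> D = hutchinson koch_maps D" for D
      using that sub[of D ?D] sub[of ?D D] \<open>0 \<in> ?D\<close> cpt inv by blast
  qed
  show "hutchinson koch_maps koch_curve = koch_curve" "compact koch_curve"
    using eq inv cpt by auto
qed

lemma koch_curve_endpoints: "0 \<in> koch_curve" "1 \<in> koch_curve"
  using koch_approximation by (auto simp: koch_curve_eq_attractor attractor_def)

lemma koch_curve_subset_triangle: "koch_curve \<subseteq> koch_triangle"
proof -
  have "attractor koch_maps koch_triangle \<subseteq> (hutchinson koch_maps ^^ 0) koch_triangle"
    unfolding attractor_def by blast
  then show ?thesis
    by (simp add: koch_curve_eq_attractor)
qed

text \<open>A decreasing intersection of compact connected sets is connected.\<close>

lemma connected_koch_curve: "connected koch_curve"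
  unfolding koch_curve_eq_attractor attractor_def
  using koch_approximation decseqD[OF hutchinson_funpow_decseq[OF koch_triangle_invariant]]
  by (intro connected_nest) auto

section \<open>How the four pieces meet\<close>

lemma koch_map_Re_bounds:
  assumes "z \<in> koch_triangle"
  shows "Re (koch_map1 z) \<le> 1 / 3" "Re (koch_map1 z) = 1 / 3 \<Longrightarrow> z = 1"
    "1 / 3 \<le> Re (koch_map2 z)"
    "Re (koch_map2 z) \<le> 1 / 2" "Re (koch_map2 z) = 1 / 2 \<Longrightarrow> z = 1"
    "1 / 2 \<le> Re (koch_map3 z)" "Re (koch_map3 z) = 1 / 2 \<Longrightarrow> z = 0"
    "Re (koch_map3 z) \<le> 2 / 3"
    "2 / 3 \<le> Re (koch_map4 z)" "Re (koch_map4 z) = 2 / 3 \<Longrightarrow> z = 0"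
proof -
  define t where "t = sqrt 3 * Im z"
  have t: "0 \<le> t" "t \<le> Re z" "t \<le> 1 - Re z"
    using assms by (auto simp: koch_triangle_def t_def)
  have q: "Im z = 0" if "t \<le> 0"
    using t(1) that by (simp add: t_def)
  show "Re (koch_map1 z) \<le> 1 / 3"
    "1 / 3 \<le> Re (koch_map2 z)" "Re (koch_map2 z) \<le> 1 / 2"
    "1 / 2 \<le> Re (koch_map3 z)" "Re (koch_map3 z) \<le> 2 / 3" "2 / 3 \<le> Re (koch_map4 z)"
    using t unfolding koch_map_Re t_def[symmetric] by - linarith+
  \<comment> \<open>At 1/2 both middle pieces pin the point. At 1/3 and 2/3 only the outer piece
    does: a whole side of the neighbouring image triangle stands vertically there.\<close>
  show "Re (koch_map1 z) = 1 / 3 \<Longrightarrow> z = 1" "Re (koch_map2 z) = 1 / 2 \<Longrightarrow> z = 1"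
    "Re (koch_map3 z) = 1 / 2 \<Longrightarrow> z = 0" "Re (koch_map4 z) = 2 / 3 \<Longrightarrow> z = 0"
    using t q by (simp_all add: koch_map_Re complex_eq_iff flip: t_def)
qed

lemma koch_maps_image_Int_countable:
  assumes "f \<in> koch_maps" "g \<in> koch_maps" "f \<noteq> g" "D \<subseteq> koch_triangle"
  shows "countable (f ` D \<inter> g ` D)"
proof -
  note b = koch_map_Re_bounds
  have "f a \<in> (\<lambda>h. h 0) ` koch_maps \<union> (\<lambda>h. h 1) ` koch_maps"
    if "f a = g b" "a \<in> koch_triangle" "b \<in> koch_triangle" for a b
  proof -
    \<comment> \<open>Real parts decide: pieces that are not neighbours lie over disjoint intervals,
      and neighbours can agree only at the common end of theirs, where one preimage is
      forced.\<close>
    have "a = 0 \<or> a = 1 \<or> b = 0 \<or> b = 1"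
      using assms(1-3) b[OF that(2)] b[OF that(3)] arg_cong[OF that(1), of Re]
      unfolding koch_maps_def by (auto; argo)
    then show ?thesis
      using assms(1,2) that(1) by (metis UnI1 UnI2 image_eqI)
  qed
  then have "f ` D \<inter> g ` D \<subseteq> (\<lambda>h. h 0) ` koch_maps \<union> (\<lambda>h. h 1) ` koch_maps"
    using assms(4) by blast
  then show ?thesis
    by (rule countable_subset) (simp add: koch_maps_def countable_finite)
qed

theorem corollary5p3:
  shows "top_hausdorff_dim koch_curve = 1"
proof (rule antisym)
  show "top_hausdorff_dim koch_curve \<le> 1"
    using dist_koch_maps inj_koch_maps continuous_koch_maps compact_koch_curve
      hutchinson_koch_curve koch_maps_image_Int_countable koch_curve_subset_triangle
    by (intro top_hausdorff_dim_self_similar_le_1[of koch_maps "1 / 3"]) (auto simp: koch_maps_def)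
  show "1 \<le> top_hausdorff_dim koch_curve"
    using top_hausdorff_dim_ge_1[OF connected_koch_curve koch_curve_endpoints] by simp
qed

end
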